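(* For symmetric three-qubit states, let $r_{\mathrm{SAS}}$ be the maximal radius of a ball centred on $\rho_0=\tfrac14\mathbb 1_4$ containing only symmetric absolutely separable states, and let $R_{\mathrm{SAS}}$ be the minimal radius of a ball centred on $\rho_0$ that contains all symmetric absolutely separable states. Then $$r_{\mathrm{SAS}}\le\frac{1}{2\sqrt{19}},\qquad R_{\mathrm{SAS}}\le\frac{\sqrt3}{10}.$$
   Context: Let $\mathcal H_1=\mathbb C^2$. The symmetric subspace $\mathcal H_1^{\vee 3}\subset\mathcal H_1^{\otimes3}$ is the 4-dimensional space of vectors invariant under all permutations of the three qubits. A symmetric three-qubit state is a density operator on $\mathcal H_1^{\otimes 3}$ supported on $\mathcal H_1^{\vee3}$, equivalently a density operator on $\mathcal H_1^{\vee3}\simeq\mathbb C^4$; $\rho_0=\frac14\mathbb 1_4$ is the maximally mixed state of the symmetric subspace. A state is separable if it is a convex combination of projectors onto product states $|\psi_1\rangle\otimes|\psi_2\rangle\otimes|\psi_3\rangle$. A symmetric state $\rho_S$ is symmetric absolutely separable (SAS) if $U_S\rho_SU_S^\dagger$ is separable for every $U_S\in SU(4)$, the special unitary group of $\mathcal H_1^{\vee 3}$. Balls are closed balls, within the set of symmetric states, for the Hilbert–Schmidt distance $\lVert\rho_S-\rho_0\rVert_{HS}=\sqrt{\mathrm{Tr}[\rho_S^2]-\frac14}$. *)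

theory Defs
  imports "HOL-Analysis.Analysis"
begin

definition hadjoint :: "complex^'n^'m \<Rightarrow> complex^'m^'n"  (\<open>(_\<^sup>\<dagger>)\<close> [1000] 999)
  where "A\<^sup>\<dagger> = (\<chi> i j. cnj (A $ j $ i))"

definition cinner :: "complex^'n \<Rightarrow> complex^'n \<Rightarrow> complex"
  where "cinner v w = (\<Sum>i\<in>UNIV. cnj (v $ i) * w $ i)"

definition ketbra :: "complex^'n \<Rightarrow> complex^'n^'n"
  where "ketbra v = (\<chi> i j. v $ i * cnj (v $ j))"

definition density_operator :: "complex^'n^'n \<Rightarrow> bool"
  where "density_operator \<rho> \<longleftrightarrow>
    \<rho>\<^sup>\<dagger> = \<rho> \<and> (\<forall>v. 0 \<le> Re (cinner v (\<rho> *v v))) \<and> trace \<rho> = 1"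

definition SU :: "(complex^'n^'n) set"
  where "SU = {u. u\<^sup>\<dagger> ** u = mat 1 \<and> u ** u\<^sup>\<dagger> = mat 1 \<and> det u = 1}"

definition hs_dist :: "complex^'n^'n \<Rightarrow> complex^'n^'n \<Rightarrow> real"
  where "hs_dist A B = sqrt (Re (trace ((A - B)\<^sup>\<dagger> ** (A - B))))"

text \<open>The computational basis of the three-qubit space is indexed by the functions from the
  three qubit labels to the two basis labels.\<close>

type_synonym bits = "3 \<Rightarrow> 2"
type_synonym ket = "complex^bits"
type_synonym operator = "complex^bits^bits"

definition tensor :: "(3 \<Rightarrow> complex^2) \<Rightarrow> ket"
  where "tensor \<psi> = (\<chi> b. \<Prod>q\<in>UNIV. \<psi> q $ b q)"

definition separable_state :: "operator \<Rightarrow> bool"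
  where "separable_state \<rho> \<longleftrightarrow>
    \<rho> \<in> convex hull {ketbra (tensor \<psi>) |\<psi>. \<forall>q. norm (\<psi> q) = 1}"

definition permute_qubits :: "(3 \<Rightarrow> 3) \<Rightarrow> ket \<Rightarrow> ket"
  where "permute_qubits \<pi> v = (\<chi> b. v $ (b \<circ> \<pi>))"

definition sym_space :: "ket set"
  where "sym_space = {v. \<forall>\<pi>. \<pi> permutes UNIV \<longrightarrow> permute_qubits \<pi> v = v}"

definition symmetric_state :: "operator \<Rightarrow> bool"
  where "symmetric_state \<rho> \<longleftrightarrow> density_operator \<rho> \<and> range (\<lambda>v. \<rho> *v v) \<subseteq> sym_space"

definition weight :: "bits \<Rightarrow> nat"
  where "weight b = card {q. b q = 1}"

text \<open>The columns of the following matrix are the four Dicke states, so it is the isometry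
  identifying the four-dimensional space with the symmetric subspace; see
  \<open>dicke_isometry\<close> and \<open>range_dicke\<close> below.  The weight is at most 3, hence its
  cast into the type of residues modulo 4 loses no information.\<close>

definition dicke :: "complex^4^bits"
  where "dicke = (\<chi> b k. if of_nat (weight b) = k
    then complex_of_real (1 / sqrt (real (3 choose weight b))) else 0)"

lemma weight_le: "weight b \<le> 3"
  unfolding weight_def by (rule order_trans[OF card_mono[of UNIV]]) auto

lemma of_nat_4_inj:
  assumes "m \<le> 3" "n \<le> 3"
  shows "of_nat m = (of_nat n :: 4) \<longleftrightarrow> m = n"
proof -
  have "m \<in> {0,1,2,3}" "n \<in> {0,1,2,3}" using assms by auto
  then show ?thesis by auto
qed

lemma of_nat_4_surj: "\<exists>w\<le>3. of_nat w = (k :: 4)"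
proof -
  consider "k = 1" | "k = 2" | "k = 3" | "k = 4" using exhaust_4 by blast
  then show ?thesis
  proof cases
    case 1 then show ?thesis by (intro exI[of _ 1]) auto
  next
    case 2 then show ?thesis by (intro exI[of _ 2]) auto
  next
    case 3 then show ?thesis by (intro exI[of _ 3]) auto
  next
    case 4 then show ?thesis by (intro exI[of _ 0]) auto
  qed
qed

lemma card_weight: "card {b. weight b = w} = 3 choose w"
proof -
  have eq2: "x = 0" if "x \<noteq> 1" for x :: 2
    using exhaust_2[of x] that by auto
  have "bij_betw (\<lambda>b. {q. b q = 1}) {b. weight b = w} {A. A \<subseteq> (UNIV :: 3 set) \<and> card A = w}"
  proof (rule bij_betw_byWitness[where f' = "\<lambda>A q. if q \<in> A then 1 else 0"])
    show "\<forall>b\<in>{b. weight b = w}. (\<lambda>q. if q \<in> {q. b q = 1} then 1 else 0) = b"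
      using eq2 by (auto simp: fun_eq_iff)
  qed (auto simp: weight_def)
  then show ?thesis
    using n_subsets[of "UNIV :: 3 set" w] by (simp add: bij_betw_same_card)
qed

lemma dicke_isometry: "dicke\<^sup>\<dagger> ** dicke = mat 1"
proof -
  have "(\<Sum>b\<in>UNIV. cnj (dicke $ b $ k) * dicke $ b $ l) = (if k = l then 1 else 0)" for k l
  proof (cases "k = l")
    case False
    then show ?thesis by (auto simp: dicke_def intro!: sum.neutral)
  next
    case True
    obtain w where w: "w \<le> 3" "of_nat w = k" using of_nat_4_surj by blast
    have iff: "of_nat (weight b) = k \<longleftrightarrow> weight b = w" for b
      using of_nat_4_inj[OF weight_le w(1)] w(2) by simp
    have "(\<Sum>b\<in>UNIV. cnj (dicke $ b $ k) * dicke $ b $ k)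
        = (\<Sum>b\<in>UNIV. if weight b = w then complex_of_real (1 / real (3 choose w)) else 0)"
      by (rule sum.cong) (auto simp: dicke_def iff simp flip: of_real_mult)
    also have "\<dots> = of_nat (card {b. weight b = w}) * complex_of_real (1 / real (3 choose w))"
      by (simp add: sum.If_cases)
    also have "\<dots> = 1" using w(1) by (simp add: card_weight)
    finally show ?thesis using True by simp
  qed
  then show ?thesis
    by (simp add: vec_eq_iff matrix_matrix_mult_def mat_def hadjoint_def)
qed

lemma weight_eq_permute:
  assumes "weight b = weight b'"
  shows "\<exists>\<pi>. \<pi> permutes UNIV \<and> b \<circ> \<pi> = b'"
proof -
  let ?A = "{q. b q = 1}" and ?A' = "{q. b' q = 1}"
  have c: "card ?A' = card ?A" using assms by (simp add: weight_def)
  then have "card (- ?A') = card (- ?A)" by (simp add: Compl_eq_Diff_UNIV card_Diff_subset)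
  with c obtain f g where f: "bij_betw f ?A' ?A" and g: "bij_betw g (- ?A') (- ?A)"
    using finite_same_card_bij[OF finite finite] by blast
  define \<pi> where "\<pi> q = (if q \<in> ?A' then f q else g q)" for q
  have "bij_betw \<pi> (?A' \<union> - ?A') (?A \<union> - ?A)"
  proof (rule bij_betw_combine)
    show "bij_betw \<pi> ?A' ?A" using f by (subst bij_betw_cong[of _ _ f]) (auto simp: \<pi>_def)
    show "bij_betw \<pi> (- ?A') (- ?A)" using g by (subst bij_betw_cong[of _ _ g]) (auto simp: \<pi>_def)
  qed auto
  then have "\<pi> permutes UNIV" by (intro bij_imp_permutes) (simp_all add: Compl_partition)
  moreover have "b (\<pi> q) = b' q" for q
  proof (cases "q \<in> ?A'")
    case True
    then have "\<pi> q \<in> ?A" using f by (simp add: \<pi>_def bij_betw_apply[OF f, simplified])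
    then show ?thesis using True by simp
  next
    case False
    then have "\<pi> q \<in> - ?A" using bij_betw_apply[OF g, of q] by (simp add: \<pi>_def)
    then show ?thesis using False exhaust_2[of "b (\<pi> q)"] exhaust_2[of "b' q"] by auto
  qed
  ultimately show ?thesis by (auto simp: fun_eq_iff)
qed

lemma weight_permute:
  assumes "\<pi> permutes UNIV"
  shows "weight (b \<circ> \<pi>) = weight b"
proof -
  have "bij \<pi>" using assms by (rule permutes_bij)
  then have "bij_betw \<pi> {q. b (\<pi> q) = 1} {q. b q = 1}"
    by (auto simp: bij_betw_def bij_def inj_on_def image_iff)
  then show ?thesis by (simp add: weight_def bij_betw_same_card)
qed

lemma range_dicke: "range (\<lambda>x. dicke *v x) = sym_space"
proof (intro equalityI subsetI)
  fix v assume "v \<in> range (\<lambda>x. dicke *v x)"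
  moreover have "dicke $ (b \<circ> \<pi>) = dicke $ b" if "\<pi> permutes UNIV" for b \<pi>
    using weight_permute[OF that, of b] by (simp add: dicke_def cong: if_cong)
  ultimately show "v \<in> sym_space"
    by (auto simp: sym_space_def permute_qubits_def vec_eq_iff matrix_vector_mult_def)
next
  fix v assume v: "v \<in> sym_space"
  have dep: "v $ b = v $ b'" if bb: "weight b = weight b'" for b b'
  proof -
    obtain \<pi> where p: "\<pi> permutes UNIV" "b \<circ> \<pi> = b'" using weight_eq_permute[OF bb] by blast
    then have "permute_qubits \<pi> v $ b = v $ b" using v by (simp add: sym_space_def)
    then show ?thesis using p by (simp add: permute_qubits_def)
  qed
  define x :: "complex^4" where "x = (\<chi> k. let b = (SOME b. of_nat (weight b) = k) in
    complex_of_real (sqrt (real (3 choose weight b))) * v $ b)"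
  have "(dicke *v x) $ b = v $ b" for b
  proof -
    define b' where "b' = (SOME b'. of_nat (weight b') = (of_nat (weight b) :: 4))"
    have "of_nat (weight b') = (of_nat (weight b) :: 4)"
      unfolding b'_def by (rule someI[of _ b]) (rule refl)
    then have eq: "weight b' = weight b" using of_nat_4_inj weight_le by blast
    have pos: "sqrt (real (3 choose weight b)) \<noteq> 0" using weight_le[of b] by simp
    have "(dicke *v x) $ b
        = complex_of_real (1 / sqrt (real (3 choose weight b))) * x $ of_nat (weight b)"
      by (simp add: matrix_vector_mult_def dicke_def if_distrib[of "\<lambda>a. a * _"] cong: if_cong)
    also have "x $ of_nat (weight b) = complex_of_real (sqrt (real (3 choose weight b))) * v $ b"
      using dep[OF eq] by (simp add: x_def Let_def b'_def[symmetric] eq)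
    finally show ?thesis using pos by simp
  qed
  then have "dicke *v x = v" by (simp add: vec_eq_iff)
  then show "v \<in> range (\<lambda>x. dicke *v x)" by (metis rangeI)
qed

definition SU_sym :: "operator set"
  where "SU_sym = {dicke ** u ** dicke\<^sup>\<dagger> |u. u \<in> (SU :: (complex^4^4) set)}"

definition rho0 :: operator
  where "rho0 = dicke ** ((1/4) *\<^sub>R mat 1) ** dicke\<^sup>\<dagger>"

definition SAS :: "operator set"
  where "SAS = {\<rho>. symmetric_state \<rho> \<and> (\<forall>U\<in>SU_sym. separable_state (U ** \<rho> ** U\<^sup>\<dagger>))}"

definition sym_ball :: "real \<Rightarrow> operator set"
  where "sym_ball r = {\<rho>. symmetric_state \<rho> \<and> hs_dist \<rho> rho0 \<le> r}"

text \<open>Both extrema are attained: the separable states form the convex hull of a compact set, so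
  \<open>SAS\<close> is compact; it contains \<open>rho0\<close> but not every symmetric state.\<close>

definition r_SAS :: real
  where "r_SAS = (GREATEST r. 0 \<le> r \<and> sym_ball r \<subseteq> SAS)"

definition R_SAS :: real
  where "R_SAS = (LEAST r. 0 \<le> r \<and> SAS \<subseteq> sym_ball r)"

end

(* Partially transposing the first qubit of the projector onto
   |011> - |100> gives an observable that is nonnegative on separable states and whose
   restriction to the symmetric subspace has eigenvalues -1, 1/3, 1/3, 1.  Since the unitary is
   arbitrary, the eigenvalues l1 >= l2 >= l3 >= l4 of a symmetric absolutely separable state satisfy
   3 l1 <= l2 + l3 + 3 l4.  On this part of the simplex the point farthest from rho0 is
   (3, 3, 3, 1)/10, at distance sqrt 3 / 10, and the bounding hyperplane comes as close to rho0 as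
   (13, 9, 9, 7)/38, at distance 1 / (2 sqrt 19). *)
theory Submission imports Defs begin

text \<open>Both radii are given by \<open>GREATEST\<close> and \<open>LEAST\<close>, which say
  nothing unless the extremum exists, so numerical bounds on admissible radii do not suffice. For
  \<open>R_SAS\<close> attainment follows from order alone. For \<open>r_SAS\<close> it needs
  topology: the separable states are closed, \<open>rho0\<close> is itself SAS, and a state on the
  boundary of a ball is a limit of its contractions towards \<open>rho0\<close>, which lie in
  smaller balls.

  The spectral inequality serves the two bounds in opposite ways: \<open>R_SAS\<close> needs that
  every SAS state obeys it, \<open>r_SAS\<close> needs one explicit state, just beyond the
  hyperplane, that violates it. The freedom to choose the unitary is nominally restricted to
  determinant one; a global phase, which conjugation does not see, removes that restriction.\<close>

section \<open>Matrices over the complex numbers\<close>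

lemma hadjoint_nth [simp]: "A\<^sup>\<dagger> $ i $ j = cnj (A $ j $ i)"
  by (simp add: hadjoint_def)

lemma hadjoint_hadjoint [simp]: "(A\<^sup>\<dagger>)\<^sup>\<dagger> = A"
  by (simp add: vec_eq_iff)

lemma hadjoint_mult: "(A ** B)\<^sup>\<dagger> = B\<^sup>\<dagger> ** A\<^sup>\<dagger>"
  by (simp add: vec_eq_iff matrix_matrix_mult_def mult.commute)

lemma matrix_mult_diff_left: "(A - B) ** C = A ** C - B ** (C :: complex^'k^'n)"
  for A B :: "complex^'n^'m"
  by (simp add: vec_eq_iff matrix_matrix_mult_def left_diff_distrib sum_subtractf)

lemma matrix_mult_diff_right: "A ** (B - C) = A ** B - A ** (C :: complex^'k^'n)"
  for A :: "complex^'n^'m"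
  by (simp add: vec_eq_iff matrix_matrix_mult_def right_diff_distrib sum_subtractf)

lemma matrix_mult_add_left: "(A + B) ** C = A ** C + B ** (C :: complex^'k^'n)"
  for A B :: "complex^'n^'m"
  by (simp add: vec_eq_iff matrix_matrix_mult_def distrib_right sum.distrib)

lemma matrix_mult_scaleR_left: "(c *\<^sub>R A) ** B = c *\<^sub>R (A ** (B :: complex^'k^'n))"
  for A :: "complex^'n^'m"
  by (simp add: vec_eq_iff matrix_matrix_mult_def scaleR_right.sum)

lemma matrix_mult_scaleR_right: "A ** (c *\<^sub>R B) = c *\<^sub>R (A ** (B :: complex^'k^'n))"
  for A :: "complex^'n^'m"
  by (simp add: vec_eq_iff matrix_matrix_mult_def scaleR_right.sum)

lemma cinner_mult_vec: "cinner v (A *v w) = cinner (A\<^sup>\<dagger> *v v) w"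
proof -
  have "cinner v (A *v w) = (\<Sum>i\<in>UNIV. \<Sum>j\<in>UNIV. cnj (v $ i) * (A $ i $ j * w $ j))"
    by (simp add: cinner_def matrix_vector_mult_def sum_distrib_left)
  also have "\<dots> = (\<Sum>j\<in>UNIV. \<Sum>i\<in>UNIV. cnj (v $ i) * (A $ i $ j * w $ j))"
    by (rule sum.swap)
  also have "\<dots> = cinner (A\<^sup>\<dagger> *v v) w"
    by (simp add: cinner_def matrix_vector_mult_def sum_distrib_left sum_distrib_right mult_ac)
  finally show ?thesis .
qed

lemma inner_eq_Re_cinner: "inner v w = Re (cinner v w)"
  by (simp add: cinner_def inner_vec_def inner_complex_def)

lemma cinner_smult_right: "cinner v (c *s w) = c * cinner v w"
  by (simp add: cinner_def sum_distrib_left mult_ac)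

lemma cinner_commute: "cinner v w = cnj (cinner w v)"
  by (simp add: cinner_def mult.commute)

lemma cinner_self: "cinner v v = of_real ((norm v)\<^sup>2)"
proof -
  have "Im (cinner v v) = 0" by (simp add: cinner_def mult.commute)
  then show ?thesis
    by (simp add: complex_eq_iff power2_norm_eq_inner inner_eq_Re_cinner)
qed

lemma Re_trace_hadjoint_mult: "Re (trace (A\<^sup>\<dagger> ** A)) = (\<Sum>i\<in>UNIV. \<Sum>j\<in>UNIV. (cmod (A $ j $ i))\<^sup>2)"
proof -
  have "cnj z * z = of_real ((cmod z)\<^sup>2)" for z
    by (metis complex_norm_square mult.commute)
  then show ?thesis
    by (simp add: trace_def matrix_matrix_mult_def)
qed

lemma trace_cyclic: "trace (A ** B) = trace (B ** (A :: complex^'n^'m))"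
  unfolding trace_def matrix_matrix_mult_def
  by (simp add: mult.commute) (rule sum.swap)

lemma trace_isometry_conj:
  fixes V :: "complex^'n^'m"
  assumes "V\<^sup>\<dagger> ** V = mat 1"
  shows "trace (V ** X ** V\<^sup>\<dagger>) = trace X"
  by (metis assms matrix_mul_assoc matrix_mul_lid trace_cyclic)

lemma hs_dist_isometry_conj:
  fixes V :: "complex^'n^'m"
  assumes "V\<^sup>\<dagger> ** V = mat 1"
  shows "hs_dist (V ** A ** V\<^sup>\<dagger>) (V ** B ** V\<^sup>\<dagger>) = hs_dist A B"
proof -
  define X where "X = A - B"
  have "V ** A ** V\<^sup>\<dagger> - V ** B ** V\<^sup>\<dagger> = V ** X ** V\<^sup>\<dagger>"
    by (simp add: X_def matrix_mult_diff_left matrix_mult_diff_right)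
  moreover have "(V ** X ** V\<^sup>\<dagger>)\<^sup>\<dagger> ** (V ** X ** V\<^sup>\<dagger>) = V ** (X\<^sup>\<dagger> ** X) ** V\<^sup>\<dagger>"
  proof -
    have "(V ** X ** V\<^sup>\<dagger>)\<^sup>\<dagger> ** (V ** X ** V\<^sup>\<dagger>) = V ** X\<^sup>\<dagger> ** (V\<^sup>\<dagger> ** V) ** X ** V\<^sup>\<dagger>"
      by (simp add: hadjoint_mult matrix_mul_assoc)
    then show ?thesis by (simp add: assms matrix_mul_assoc)
  qed
  ultimately show ?thesis
    by (simp add: hs_dist_def trace_isometry_conj[OF assms] X_def)
qed

lemma hs_dist_scaleR: "hs_dist ((1 - e) *\<^sub>R A + e *\<^sub>R B) B = \<bar>1 - e\<bar> * hs_dist A B"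
proof -
  have "(1 - e) *\<^sub>R A + e *\<^sub>R B - B = (1 - e) *\<^sub>R (A - B)"
    by (simp add: algebra_simps)
  then show ?thesis
    by (simp add: hs_dist_def Re_trace_hadjoint_mult power_mult_distrib real_sqrt_mult
        flip: sum_distrib_left)
qed

lemma hs_dist_nonneg: "0 \<le> hs_dist A B"
  by (simp add: hs_dist_def Re_trace_hadjoint_mult sum_nonneg)

lemma hs_dist_eq_0: "hs_dist A B = 0 \<longleftrightarrow> A = B"
  by (simp add: hs_dist_def Re_trace_hadjoint_mult sum_nonneg_eq_0_iff sum_nonneg)
    (auto simp: vec_eq_iff)

section \<open>The spectral theorem\<close>

text \<open>Rayleigh's argument: let \<open>v\<close> maximise the quadratic form of
  \<open>B\<close> on the unit sphere of \<open>S\<close>. The form of \<open>C = \<mu> - B\<close>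
  is then nonnegative on \<open>S\<close> and vanishes at \<open>v\<close>, which forces
  \<open>C v = 0\<close>. It is stated over the reals so that a complex space can be used as a real
  Euclidean one.\<close>

lemma symmetric_linear_eigenvector:
  fixes B :: "'a::euclidean_space \<Rightarrow> 'a"
  assumes lin: "linear B" and sym: "\<And>v w. inner v (B w) = inner (B v) w"
    and S: "subspace S" "B ` S \<subseteq> S" "S \<noteq> {0}"
  obtains v \<mu> where "v \<in> S" "norm v = 1" "B v = \<mu> *\<^sub>R v"
proof -
  obtain x where x: "x \<in> S" "x \<noteq> 0" using S subspace_0 by fastforce
  have "x /\<^sub>R norm x \<in> S \<inter> sphere 0 1"
    using x S(1) by (simp add: subspace_scale)
  then have ne: "S \<inter> sphere 0 1 \<noteq> {}" by blast
  have "compact (S \<inter> sphere 0 1)"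
    by (simp add: S(1) closed_subspace closed_Int_compact)
  moreover have "continuous_on (S \<inter> sphere 0 1) (\<lambda>v. inner v (B v))"
    using linear_continuous_on[OF linear_conv_bounded_linear[THEN iffD1, OF lin]]
    by (intro continuous_on_inner continuous_on_id)
  ultimately obtain v where "v \<in> S \<inter> sphere 0 1"
    and sup: "\<forall>w\<in>S \<inter> sphere 0 1. inner w (B w) \<le> inner v (B v)"
    using continuous_attains_sup[OF _ ne] by blast
  then have v: "v \<in> S" "norm v = 1" by simp_all
  have max: "inner w (B w) \<le> inner v (B v)" if "w \<in> S" "norm w = 1" for w
    using sup that by simp
  define \<mu> where "\<mu> = inner v (B v)"
  define C where "C w = \<mu> *\<^sub>R w - B w" for w
  have linC: "linear C" unfolding C_def
    by (intro linear_compose_sub linear_compose_scale_right linear_ident lin)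
  have symC: "inner v (C w) = inner (C v) w" for v w
    by (simp add: C_def inner_diff sym)
  have CS: "C w \<in> S" if "w \<in> S" for w
    using that S by (auto simp: C_def intro!: subspace_diff subspace_scale)
  have nonneg: "0 \<le> inner w (C w)" if "w \<in> S" for w
  proof (cases "w = 0")
    case False
    define u where "u = w /\<^sub>R norm w"
    have "u \<in> S" "norm u = 1" using False that S(1) by (auto simp: u_def subspace_scale)
    then have "inner u (B u) \<le> \<mu>" by (simp add: max \<mu>_def)
    moreover have "inner u u = 1" using \<open>norm u = 1\<close> by (simp add: norm_eq_1)
    ultimately have "0 \<le> inner u (C u)"
      by (simp add: C_def inner_diff)
    moreover have "inner u (C u) = inner w (C w) / (norm w)\<^sup>2"
      by (simp add: u_def linear_scale[OF linC] power2_eq_square divide_simps)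
    ultimately show ?thesis using False by (simp add: zero_le_divide_iff)
  qed simp
  have zero: "inner v (C v) = 0"
    using v(2) by (simp add: C_def inner_diff \<mu>_def norm_eq_1)
  define n where "n = inner (C v) (C v)"
  define q where "q = inner (C v) (C (C v))"
  have q: "0 \<le> q" unfolding q_def using nonneg CS v(1) by blast
  have n: "0 \<le> n" by (simp add: n_def)
  \<comment> \<open>The form of \<open>C\<close> is perturbed from its zero \<open>v\<close> in the
    direction \<open>- C v\<close>; its first-order term \<open>- 2 * t * n\<close> must be absorbed
    by the second-order one for every \<open>t\<close>.\<close>
  have le: "2 * t * n \<le> t * t * q" for t
  proof -
    have "v - t *\<^sub>R C v \<in> S" using CS v(1) S(1) by (simp add: subspace_diff subspace_scale)
    then have "0 \<le> inner (v - t *\<^sub>R C v) (C (v - t *\<^sub>R C v))" by (rule nonneg)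
    also have "\<dots> = inner v (C v) - t * inner v (C (C v)) - t * n + t * t * q"
      by (simp add: linear_diff[OF linC] linear_scale[OF linC] inner_diff n_def q_def algebra_simps)
    also have "inner v (C (C v)) = n" by (simp add: n_def symC)
    finally show ?thesis using zero by (simp add: mult_ac)
  qed
  have "n = 0"
  proof (rule ccontr)
    assume "n \<noteq> 0"
    with n have "0 < n" by simp
    \<comment> \<open>Any positive \<open>t\<close> with \<open>t * q < 2 * n\<close> contradicts
      \<open>le\<close>; the \<open>+ 1\<close> covers the case \<open>q = 0\<close>.\<close>
    define t where "t = n / (q + 1)"
    have t: "0 < t" "t * (q + 1) = n" using \<open>0 < n\<close> q by (simp_all add: t_def)
    have "t * (2 * n) \<le> t * (t * q)" using le[of t] by (simp add: mult_ac)
    then have "2 * n \<le> t * q" using t(1) by simp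
    with t \<open>0 < n\<close> show False by (simp add: distrib_left)
  qed
  then have "B v = \<mu> *\<^sub>R v" by (simp add: n_def C_def)
  with v that show thesis by blast
qed

text \<open>The complex orthogonal complement \<open>S\<close> of the eigenvectors found so far is
  invariant under \<open>A\<close>, because \<open>A\<close> is Hermitian and the \<open>l i\<close>
  are real. It is nonzero by counting real dimensions.\<close>

lemma hermitian_eigenvector:
  fixes A :: "complex^'n^'n" and f :: "'n \<Rightarrow> complex^'n"
  assumes A: "A\<^sup>\<dagger> = A" and I: "I \<noteq> UNIV"
    and eig: "\<And>i. i \<in> I \<Longrightarrow> A *v f i = l i *\<^sub>R f i"
  obtains v \<mu> where "norm v = 1" "\<And>i. i \<in> I \<Longrightarrow> cinner (f i) v = 0" "A *v v = \<mu> *\<^sub>R v"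
proof -
  define S where "S = {w. \<forall>i\<in>I. cinner (f i) w = 0}"
  have "cinner u (v + w) = cinner u v + cinner u w" for u v w :: "complex^'n"
    by (simp add: cinner_def distrib_left sum.distrib)
  moreover have sc: "cinner u (c *\<^sub>R v) = c *\<^sub>R cinner u v" for c and u v :: "complex^'n"
    by (simp add: cinner_def scaleR_right.sum)
  moreover have sc': "cinner (c *\<^sub>R u) v = c *\<^sub>R cinner u v" for c and u v :: "complex^'n"
    by (simp add: cinner_def scaleR_right.sum)
  ultimately have "subspace S" by (auto simp: S_def subspace_def cinner_def)
  moreover have "(*v) A ` S \<subseteq> S"
    by (auto simp: S_def cinner_mult_vec A eig sc')
  moreover have "S \<noteq> {0}"
  proof -
    \<comment> \<open>Real orthogonality to \<open>f i\<close> kills only the real part of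
      \<open>cinner\<close>; adding \<open>\<i> *s f i\<close> kills the imaginary part. Hence two
      real vectors per index, against real dimension twice \<open>CARD('n)\<close>.\<close>
    define T where "T = f ` I \<union> (\<lambda>i. \<i> *s f i) ` I"
    have "dim T \<le> card T" by (simp add: T_def dim_le_card')
    also have "\<dots> \<le> card (f ` I) + card ((\<lambda>i. \<i> *s f i) ` I)"
      unfolding T_def by (rule card_Un_le)
    also have "\<dots> \<le> card I + card I" by (intro add_mono card_image_le) simp_all
    also have "\<dots> < DIM(complex^'n)"
      using I psubset_card_mono[of UNIV I] by (simp add: psubset_eq)
    finally obtain x where x: "x \<noteq> 0" "\<And>y. y \<in> span T \<Longrightarrow> orthogonal x y"
      using orthogonal_to_subspace_exists by blast
    have "cinner (f i) x = 0" if "i \<in> I" for i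
    proof -
      have "orthogonal x (f i)" "orthogonal x (\<i> *s f i)"
        using that by (auto simp: T_def intro!: x(2) span_base)
      then have "Re (cinner x (f i)) = 0" "Im (cinner x (f i)) = 0"
        by (simp_all add: orthogonal_def inner_eq_Re_cinner cinner_smult_right)
      then show ?thesis using cinner_commute[of "f i" x] by (simp add: complex_eq_iff)
    qed
    then have "x \<in> S" by (simp add: S_def)
    with x show ?thesis by blast
  qed
  moreover have "inner v (A *v w) = inner (A *v v) w" for v w
    by (simp add: inner_eq_Re_cinner cinner_mult_vec A)
  ultimately obtain v \<mu> where "v \<in> S" "norm v = 1" "A *v v = \<mu> *\<^sub>R v"
    using symmetric_linear_eigenvector[OF matrix_vector_mul_linear] by metis
  then show thesis using that unfolding S_def by blast
qed

definition real_diag :: "('n \<Rightarrow> real) \<Rightarrow> complex^'n^'n"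
  where "real_diag l = (\<chi> i j. if i = j then of_real (l i) else 0)"

lemma hadjoint_real_diag: "(real_diag l)\<^sup>\<dagger> = real_diag l"
  by (simp add: real_diag_def vec_eq_iff)

lemma conj_real_diag_nth:
  "(V ** real_diag l ** V\<^sup>\<dagger>) $ i $ j = (\<Sum>k\<in>UNIV. of_real (l k) * V $ i $ k * cnj (V $ j $ k))"
  by (simp add: matrix_matrix_mult_def real_diag_def if_distrib[of "\<lambda>a. _ * a"] mult_ac
      cong: if_cong)

text \<open>Orthonormal eigenvectors are collected by induction over sets of indices, so that for
  \<open>UNIV\<close> they are already the columns of a square matrix.\<close>

theorem hermitian_spectral:
  fixes A :: "complex^'n^'n"
  assumes A: "A\<^sup>\<dagger> = A"
  obtains V :: "complex^'n^'n" and l where "V\<^sup>\<dagger> ** V = mat 1" "A = V ** real_diag l ** V\<^sup>\<dagger>"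
proof -
  have "\<exists>f l. \<forall>i\<in>I. A *v f i = l i *\<^sub>R f i \<and> (\<forall>j\<in>I. cinner (f i) (f j) = (if i = j then 1 else 0))"
    for I :: "'n set"
    using finite[of I]
  proof (induction I rule: finite_induct)
    case (insert k I)
    then obtain f and l :: "'n \<Rightarrow> real" where f: "\<And>i. i \<in> I \<Longrightarrow> A *v f i = l i *\<^sub>R f i"
      "\<And>i j. i \<in> I \<Longrightarrow> j \<in> I \<Longrightarrow> cinner (f i) (f j) = (if i = j then 1 else 0)"
      by blast
    from insert.hyps have "I \<noteq> UNIV" by blast
    then obtain v \<mu>
      where v: "norm v = 1" "\<And>i. i \<in> I \<Longrightarrow> cinner (f i) v = 0" "A *v v = \<mu> *\<^sub>R v"
      using hermitian_eigenvector[OF A, of I f l] f(1) by blast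
    have "cinner v (f i) = 0" if "i \<in> I" for i
      using v(2)[OF that] cinner_commute[of v] by simp
    moreover have "cinner v v = 1" using v(1) by (simp add: cinner_self)
    ultimately show ?case using v f \<open>k \<notin> I\<close>
      by (intro exI[of _ "f(k := v)"] exI[of _ "l(k := \<mu>)"]) auto
  qed simp
  from this[of UNIV] obtain f and l :: "'n \<Rightarrow> real" where f: "\<And>i. A *v f i = l i *\<^sub>R f i"
    "\<And>i j. cinner (f i) (f j) = (if i = j then 1 else 0)"
    by blast
  define V where "V = (\<chi> i j. f j $ i)"
  have V: "V\<^sup>\<dagger> ** V = mat 1"
    using f(2) by (simp add: V_def vec_eq_iff matrix_matrix_mult_def mat_def cinner_def)
  have "(A ** V) $ i $ j = (V ** real_diag l) $ i $ j" for i j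
  proof -
    have "(A ** V) $ i $ j = (A *v f j) $ i"
      by (simp add: V_def matrix_matrix_mult_def matrix_vector_mult_def)
    also have "\<dots> = (V ** real_diag l) $ i $ j"
      by (simp add: f(1) V_def matrix_matrix_mult_def real_diag_def
          if_distrib[of "\<lambda>a. _ * a"] scaleR_conv_of_real[where 'a = complex] mult.commute cong: if_cong)
    finally show ?thesis .
  qed
  then have "A ** V = V ** real_diag l" by (simp add: vec_eq_iff)
  moreover have "V ** V\<^sup>\<dagger> = mat 1" using V matrix_left_right_inverse by blast
  ultimately have "A = V ** real_diag l ** V\<^sup>\<dagger>"
    by (metis matrix_mul_assoc matrix_mul_rid)
  with V show thesis by (rule that)
qed

section \<open>Density operators, distances and determinant-one unitaries\<close>

lemma density_operator_isometry_conj: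
  fixes V :: "complex^'n^'m"
  assumes V: "V\<^sup>\<dagger> ** V = mat 1" and X: "density_operator X"
  shows "density_operator (V ** X ** V\<^sup>\<dagger>)"
proof -
  have "cinner v ((V ** X ** V\<^sup>\<dagger>) *v v) = cinner (V\<^sup>\<dagger> *v v) (X *v (V\<^sup>\<dagger> *v v))" for v
    by (simp add: cinner_mult_vec[of v V] flip: matrix_vector_mul_assoc)
  with X show ?thesis
    by (simp add: density_operator_def trace_isometry_conj[OF V] hadjoint_mult matrix_mul_assoc)
qed

lemma density_operator_real_diag:
  assumes "\<And>i. 0 \<le> l i" "sum l UNIV = 1"
  shows "density_operator (real_diag l)"
proof -
  have "0 \<le> Re (cinner v (real_diag l *v v))" for v
  proof -
    have "(real_diag l *v v) $ i = of_real (l i) * v $ i" for i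
      by (simp add: matrix_vector_mult_def real_diag_def if_distrib[of "\<lambda>a. a * _"] cong: if_cong)
    moreover have "Re (cnj z * (of_real a * z)) = a * (cmod z)\<^sup>2" for a z
      by (simp add: cmod_power2) (simp add: power2_eq_square algebra_simps)
    ultimately have "Re (cinner v (real_diag l *v v)) = (\<Sum>i\<in>UNIV. l i * (cmod (v $ i))\<^sup>2)"
      by (simp add: cinner_def)
    then show ?thesis using assms(1) by (simp add: sum_nonneg)
  qed
  moreover have "trace (real_diag l) = 1"
    using assms(2) by (simp add: trace_def real_diag_def flip: of_real_sum)
  ultimately show ?thesis by (simp add: density_operator_def hadjoint_real_diag)
qed

lemma hs_dist_real_diag: "hs_dist (real_diag l) (c *\<^sub>R mat 1) = sqrt (\<Sum>i\<in>UNIV. (l i - c)\<^sup>2)"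
proof -
  have "(cmod ((real_diag l - c *\<^sub>R mat 1) $ j $ i))\<^sup>2 = (if i = j then (l i - c)\<^sup>2 else 0)" for i j
    by (simp add: real_diag_def mat_def scaleR_conv_of_real[where 'a = complex] flip: of_real_diff)
  then show ?thesis by (simp add: hs_dist_def Re_trace_hadjoint_mult)
qed

lemma hs_dist_unitary_diag_scaled_id:
  fixes V :: "complex^'n^'n"
  assumes "V\<^sup>\<dagger> ** V = mat 1"
  shows "hs_dist (V ** real_diag l ** V\<^sup>\<dagger>) (c *\<^sub>R mat 1) = sqrt (\<Sum>i\<in>UNIV. (l i - c)\<^sup>2)"
proof -
  have "V ** V\<^sup>\<dagger> = mat 1" using assms matrix_left_right_inverse by blast
  then have "c *\<^sub>R mat 1 = V ** (c *\<^sub>R mat 1) ** V\<^sup>\<dagger>"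
    by (simp add: matrix_mult_scaleR_left matrix_mult_scaleR_right)
  then show ?thesis
    using hs_dist_isometry_conj[OF assms] hs_dist_real_diag by metis
qed

text \<open>The determinant has modulus one, so some phase \<open>c\<close> satisfies
  \<open>c ^ n * det u = 1\<close>; multiplying \<open>u\<close> by \<open>c\<close> normalises the
  determinant, and \<open>c\<close> cancels against its conjugate in every conjugation.\<close>

lemma unitary_phase_to_SU:
  fixes u :: "complex^'n^'n"
  assumes u: "u\<^sup>\<dagger> ** u = mat 1"
  obtains w where "w \<in> SU" "\<forall>X. w ** X ** w\<^sup>\<dagger> = u ** X ** u\<^sup>\<dagger>"
proof -
  have "det (u\<^sup>\<dagger>) = cnj (det u)"
  proof -
    have "u\<^sup>\<dagger> = transpose (\<chi> i j. cnj (u $ i $ j))" by (simp add: vec_eq_iff transpose_def)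
    moreover have "det (\<chi> i j. cnj (u $ i $ j)) = cnj (det u)" by (simp add: det_def)
    ultimately show ?thesis by (simp add: det_transpose)
  qed
  then have "cnj (det u) * det u = 1"
    by (metis u det_I det_mul)
  then have "(cmod (det u))\<^sup>2 = 1"
    by (metis complex_norm_square mult.commute of_real_eq_1_iff)
  then have nd: "cmod (det u) = 1" using norm_ge_zero[of "det u"] by (auto simp: power2_eq_1_iff simp del: norm_ge_zero)
  define n where "n = CARD('n)"
  have npos: "n > 0" by (simp add: n_def)
  define c where "c = cis (- (Arg (det u)) / n)"
  have "c ^ n * det u = 1"
  proof -
    have "c ^ n = cis (real n * (- Arg (det u) / n))" unfolding c_def by (rule Complex.DeMoivre)
    moreover have "real n * (- Arg (det u) / n) = - Arg (det u)" using npos by simp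
    moreover have "det u = cis (Arg (det u))" using nd rcis_cmod_Arg[of "det u"] by (simp add: rcis_def)
    ultimately show ?thesis by (metis cis_mult cis_zero add.left_inverse)
  qed
  have cc: "cnj c * c = 1" "c * cnj c = 1" by (simp_all add: c_def cis_cnj cis_mult)
  define w where "w = mat c ** u"
  have dag: "w\<^sup>\<dagger> = u\<^sup>\<dagger> ** mat (cnj c)"
  proof -
    have "(mat c :: complex^'n^'n)\<^sup>\<dagger> = mat (cnj c)" by (simp add: vec_eq_iff mat_def)
    then show ?thesis by (simp add: w_def hadjoint_mult)
  qed
  have conj: "w ** X ** w\<^sup>\<dagger> = u ** X ** u\<^sup>\<dagger>" for X
  proof -
    have "mat c ** Y ** mat (cnj c) = Y" for Y :: "complex^'n^'n"
      using cc by (simp add: vec_eq_iff mat_def matrix_matrix_mult_def if_distrib[of "\<lambda>a. a * _"]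
          if_distrib[of "\<lambda>a. _ * a"] mult_ac cong: if_cong)
    from this[of "u ** X ** u\<^sup>\<dagger>"] show ?thesis unfolding dag by (simp add: w_def matrix_mul_assoc)
  qed
  have "u ** u\<^sup>\<dagger> = mat 1" using u matrix_left_right_inverse by blast
  with conj[of "mat 1"] have ww: "w ** w\<^sup>\<dagger> = mat 1" by simp
  moreover from ww have "w\<^sup>\<dagger> ** w = mat 1" using matrix_left_right_inverse by blast
  moreover have "det w = 1"
  proof -
    have "det (mat c :: complex^'n^'n) = c ^ n"
      by (subst det_diagonal) (simp_all add: mat_def n_def)
    with \<open>c ^ n * det u = 1\<close> show ?thesis by (simp add: w_def det_mul)
  qed
  ultimately have "w \<in> SU" by (simp add: SU_def)
  with conj that show thesis by blast
qed

section \<open>Symmetric three-qubit operators\<close>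

text \<open>The projector \<open>dicke ** dicke\<^sup>\<dagger>\<close> fixes the range of
  \<open>\<rho>\<close>, hence absorbs into \<open>\<rho>\<close> from the left and, taking
  adjoints, from the right. \<open>X\<close> is the compression of \<open>\<rho>\<close>.\<close>

lemma symmetric_state_decompose:
  assumes "symmetric_state \<rho>"
  obtains X :: "complex^4^4" where "\<rho> = dicke ** X ** dicke\<^sup>\<dagger>" "X\<^sup>\<dagger> = X" "trace X = 1"
proof -
  have herm: "\<rho>\<^sup>\<dagger> = \<rho>" and tr: "trace \<rho> = 1"
    using assms by (simp_all add: symmetric_state_def density_operator_def)
  have "(dicke ** dicke\<^sup>\<dagger> ** \<rho>) *v v = \<rho> *v v" for v
  proof -
    have "\<rho> *v v \<in> range (\<lambda>x. dicke *v x)"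
      using assms by (auto simp: symmetric_state_def range_dicke)
    then obtain x where x: "\<rho> *v v = dicke *v x" by blast
    have "(dicke ** dicke\<^sup>\<dagger> ** \<rho>) *v v = (dicke ** (dicke\<^sup>\<dagger> ** dicke)) *v x"
      by (simp add: x flip: matrix_vector_mul_assoc)
    then show ?thesis by (simp add: dicke_isometry x)
  qed
  then have 1: "dicke ** dicke\<^sup>\<dagger> ** \<rho> = \<rho>" by (simp add: matrix_eq)
  then have 2: "\<rho> ** (dicke ** dicke\<^sup>\<dagger>) = \<rho>"
    by (metis hadjoint_hadjoint hadjoint_mult herm)
  let ?X = "dicke\<^sup>\<dagger> ** \<rho> ** dicke"
  have eq: "\<rho> = dicke ** ?X ** dicke\<^sup>\<dagger>"
    using 1 2 by (metis matrix_mul_assoc)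
  moreover have "?X\<^sup>\<dagger> = ?X" by (simp add: hadjoint_mult herm matrix_mul_assoc)
  moreover have "trace ?X = 1"
    using tr trace_isometry_conj[OF dicke_isometry, of ?X] eq by simp
  ultimately show thesis by (rule that)
qed

lemma symmetric_state_dicke_conj:
  assumes "density_operator X"
  shows "symmetric_state (dicke ** X ** dicke\<^sup>\<dagger>)"
  using density_operator_isometry_conj[OF dicke_isometry assms] range_dicke
  by (auto simp: symmetric_state_def simp flip: matrix_vector_mul_assoc)

lemma hs_dist_rho0: "hs_dist (dicke ** X ** dicke\<^sup>\<dagger>) rho0 = hs_dist X ((1/4) *\<^sub>R mat 1)"
  unfolding rho0_def by (rule hs_dist_isometry_conj[OF dicke_isometry])

lemma dicke_conj_nth:
  "(dicke ** X ** dicke\<^sup>\<dagger>) $ b $ b' = X $ of_nat (weight b) $ of_nat (weight b') *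
    complex_of_real (1 / (sqrt (real (3 choose weight b)) * sqrt (real (3 choose weight b'))))"
  by (simp add: matrix_matrix_mult_def dicke_def if_distrib[of "\<lambda>a. a * _"]
      if_distrib[of "\<lambda>a. _ * a"] if_distrib[of cnj] cong: if_cong)

lemma tensor_const:
  "tensor (\<lambda>_. \<chi> j. if j = 1 then \<beta> else \<alpha>) $ b = \<beta> ^ weight b * \<alpha> ^ (3 - weight b)"
proof -
  have "tensor (\<lambda>_. \<chi> j. if j = 1 then \<beta> else \<alpha>) $ b = (\<Prod>q\<in>UNIV. if b q = 1 then \<beta> else \<alpha>)"
    by (simp add: tensor_def)
  also have "\<dots> = \<beta> ^ card {q. b q = 1} * \<alpha> ^ card (- {q. b q = 1})"
    by (simp add: prod.If_cases)
  also have "card (- {q. b q = 1}) = 3 - card {q. b q = 1}"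
    by (simp add: Compl_eq_Diff_UNIV card_Diff_subset)
  finally show ?thesis by (simp add: weight_def)
qed

section \<open>The entanglement witness\<close>

definition ket011 :: bits where "ket011 = (\<lambda>q. if q = 1 then 0 else 1)"
definition ket100 :: bits where "ket100 = (\<lambda>q. if q = 1 then 1 else 0)"

text \<open>Transposing the first qubit turns the coherences between 011 and 100 into those between
  111 and 000; this is the expectation of the resulting, unnormalised observable in
  \<open>\<sigma>\<close>. On the symmetric subspace its negative eigenvector is the GHZ
  state.\<close>

definition ghz_witness :: "operator \<Rightarrow> real"
  where "ghz_witness \<sigma> = Re (\<sigma> $ ket011 $ ket011 + \<sigma> $ ket100 $ ket100
    - \<sigma> $ (\<lambda>_. 1) $ (\<lambda>_. 0) - \<sigma> $ (\<lambda>_. 0) $ (\<lambda>_. 1))"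

text \<open>On a product of the vectors \<open>(x\<^sub>q, y\<^sub>q)\<close> the witness equals
  \<open>\<bar>cnj x\<^sub>1 y\<^sub>2 y\<^sub>3 - cnj y\<^sub>1 x\<^sub>2 x\<^sub>3\<bar>\<^sup>2\<close>: it comes from the partial transposition of the first qubit.\<close>

lemma ghz_witness_product_nonneg: "0 \<le> ghz_witness (ketbra (tensor \<psi>))"
proof -
  define x y where "x q = \<psi> q $ 0" and "y q = \<psi> q $ 1" for q
  have prod3: "(\<Prod>q\<in>UNIV. f q) = f 1 * f 2 * f 3" for f :: "3 \<Rightarrow> complex"
    unfolding UNIV_3 by (simp add: mult.assoc)
  have t: "tensor \<psi> $ ket011 = x 1 * (y 2 * y 3)" "tensor \<psi> $ ket100 = y 1 * (x 2 * x 3)"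
    "tensor \<psi> $ (\<lambda>_. 1) = y 1 * (y 2 * y 3)" "tensor \<psi> $ (\<lambda>_. 0) = x 1 * (x 2 * x 3)"
    by (simp_all add: tensor_def prod3 ket011_def ket100_def x_def y_def mult.assoc)
  have "Re (a * p * cnj (a * p) + b * q * cnj (b * q) - b * p * cnj (a * q) - a * q * cnj (b * p))
      = (cmod (cnj a * p - cnj b * q))\<^sup>2" for a b p q
  proof -
    have "a * p * cnj (a * p) + b * q * cnj (b * q) - b * p * cnj (a * q) - a * q * cnj (b * p)
        = (cnj a * p - cnj b * q) * cnj (cnj a * p - cnj b * q)"
      by (simp add: algebra_simps)
    also have "\<dots> = of_real ((cmod (cnj a * p - cnj b * q))\<^sup>2)"
      by (rule complex_norm_square[symmetric])
    finally show ?thesis by (simp only: Re_complex_of_real)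
  qed
  then have "ghz_witness (ketbra (tensor \<psi>))
      = (cmod (cnj (x 1) * (y 2 * y 3) - cnj (y 1) * (x 2 * x 3)))\<^sup>2"
    unfolding ghz_witness_def ketbra_def vec_lambda_beta t by blast
  then show ?thesis by simp
qed

lemma separable_ghz_witness_nonneg:
  assumes "separable_state \<sigma>"
  shows "0 \<le> ghz_witness \<sigma>"
proof -
  have "convex {\<sigma>. 0 \<le> ghz_witness \<sigma>}"
  proof (rule convexI)
    fix A B :: operator and u v :: real
    assume "A \<in> {\<sigma>. 0 \<le> ghz_witness \<sigma>}" "B \<in> {\<sigma>. 0 \<le> ghz_witness \<sigma>}" "0 \<le> u" "0 \<le> v"
    moreover have "ghz_witness (u *\<^sub>R A + v *\<^sub>R B) = u * ghz_witness A + v * ghz_witness B"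
      by (simp add: ghz_witness_def algebra_simps)
    ultimately show "u *\<^sub>R A + v *\<^sub>R B \<in> {\<sigma>. 0 \<le> ghz_witness \<sigma>}" by simp
  qed
  moreover have "{ketbra (tensor \<psi>) |\<psi>. \<forall>q. norm (\<psi> q) = 1} \<subseteq> {\<sigma>. 0 \<le> ghz_witness \<sigma>}"
    using ghz_witness_product_nonneg by blast
  ultimately have "convex hull {ketbra (tensor \<psi>) |\<psi>. \<forall>q. norm (\<psi> q) = 1} \<subseteq> {\<sigma>. 0 \<le> ghz_witness \<sigma>}"
    by (intro hull_minimal) auto
  with assms show ?thesis unfolding separable_state_def by blast
qed

text \<open>The columns are an eigenbasis of the restriction of the witness to the symmetric subspace,
  ordered by increasing eigenvalue.  Row and column 4 (that is, 0) belongs to the Dicke state of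
  weight 0.\<close>

definition witness_basis :: "complex^4^4"
  where "witness_basis = (\<chi> i k.
    if i = 1 then (if k = 2 then 1 else 0)
    else if i = 2 then (if k = 3 then 1 else 0)
    else if k = 1 then complex_of_real (1 / sqrt 2)
    else if k = 4 then complex_of_real (if i = 3 then - 1 / sqrt 2 else 1 / sqrt 2)
    else 0)"

lemma witness_basis_unitary: "witness_basis\<^sup>\<dagger> ** witness_basis = mat 1"
  by (simp add: vec_eq_iff forall_4 matrix_matrix_mult_def sum_4 mat_def witness_basis_def
      flip: of_real_mult of_real_add)

text \<open>The third comes from the Dicke normalisation: 011 and 100 are each one of three strings
  of their weight. The GHZ coherences join weights 0 and 3, which have one string each.\<close>

lemma ghz_witness_spectral:
  "ghz_witness (dicke ** (witness_basis ** real_diag l ** witness_basis\<^sup>\<dagger>) ** dicke\<^sup>\<dagger>)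
    = (l 2 + l 3) / 3 - l 1 + l 4"
proof -
  have "{q::3. q \<noteq> 1} = {2, 3}" using exhaust_3 by auto
  then have w: "weight ket011 = 2" "weight ket100 = 1" "weight (\<lambda>_. 1) = 3" "weight (\<lambda>_. 0) = 0"
    by (simp_all add: weight_def ket011_def ket100_def)
  have c: "3 choose 2 = (3::nat)" by (simp add: eval_nat_numeral)
  show ?thesis
    unfolding ghz_witness_def dicke_conj_nth w
    by (simp add: conj_real_diag_nth sum_4 witness_basis_def c)
qed

text \<open>A permutation maximising \<open>F\<close>, whose weights are 3, 2, 1, 0, sorts
  decreasingly: swapping neighbouring places changes \<open>F\<close> by exactly the difference of
  their values.\<close>

lemma sorting_permutation_4:
  fixes l :: "4 \<Rightarrow> real"
  obtains \<pi> where "\<pi> permutes UNIV" "l (\<pi> 2) \<le> l (\<pi> 1)" "l (\<pi> 3) \<le> l (\<pi> 2)" "l (\<pi> 4) \<le> l (\<pi> 3)"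
proof -
  define F where "F \<pi> = 3 * l (\<pi> 1) + 2 * l (\<pi> 2) + l (\<pi> 3)" for \<pi> :: "4 \<Rightarrow> 4"
  let ?S = "{\<pi> :: 4 \<Rightarrow> 4. \<pi> permutes UNIV}"
  have fin: "finite ?S" and ne: "?S \<noteq> {}" using permutes_id[of "UNIV :: 4 set"] by (simp, blast)
  then have "Max (F ` ?S) \<in> F ` ?S" by (intro Max_in) auto
  then obtain \<pi> where \<pi>: "\<pi> permutes UNIV" "Max (F ` ?S) = F \<pi>" by auto
  have swap: "F (\<pi> \<circ> Transposition.transpose i j) \<le> F \<pi>" for i j
  proof -
    have "\<pi> \<circ> Transposition.transpose i j permutes UNIV"
      by (intro permutes_compose permutes_swap_id \<pi>) auto
    then show ?thesis using \<pi>(2) fin by (metis Max_ge finite_imageI image_eqI mem_Collect_eq)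
  qed
  show thesis
    using swap[of 1 2] swap[of 2 3] swap[of 3 4]
    by (intro that[of \<pi>] \<pi>) (simp_all add: F_def Transposition.transpose_def)
qed

section \<open>Spectra of symmetric absolutely separable states\<close>

text \<open>The unitary \<open>witness_basis ** W\<^sup>\<dagger>\<close> carries the eigenvector
  for \<open>l (\<pi> k)\<close> to the \<open>k\<close>-th witness eigenvector, so nonnegativity of
  the witness on the rotated state is the claim divided by 3. Decreasing order gives the strongest
  inequality, pairing the largest eigenvalue with -1 and the smallest with 1.\<close>

lemma SAS_spectrum:
  fixes V :: "complex^4^4"
  assumes V: "V\<^sup>\<dagger> ** V = mat 1" and \<pi>: "\<pi> permutes UNIV"
    and sas: "dicke ** (V ** real_diag l ** V\<^sup>\<dagger>) ** dicke\<^sup>\<dagger> \<in> SAS"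
  shows "3 * l (\<pi> 1) \<le> l (\<pi> 2) + l (\<pi> 3) + 3 * l (\<pi> 4)"
proof -
  define W where "W = (\<chi> i j. V $ i $ \<pi> j)"
  have VV: "(\<Sum>k\<in>UNIV. cnj (V $ k $ i) * V $ k $ j) = (if i = j then 1 else 0)" for i j
    using V by (simp add: vec_eq_iff matrix_matrix_mult_def mat_def)
  have inj: "inj \<pi>" using \<pi> by (rule permutes_inj)
  have W: "W\<^sup>\<dagger> ** W = mat 1"
    by (simp add: vec_eq_iff matrix_matrix_mult_def mat_def W_def VV inj_eq[OF inj])
  have X: "V ** real_diag l ** V\<^sup>\<dagger> = W ** real_diag (l \<circ> \<pi>) ** W\<^sup>\<dagger>"
    unfolding vec_eq_iff conj_real_diag_nth W_def
    using sum.permute[OF \<pi>, of "\<lambda>k. of_real (l k) * V $ i $ k * cnj (V $ j $ k)" for i j]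
    by (simp add: o_def)
  let ?u = "witness_basis ** W\<^sup>\<dagger>"
  have "witness_basis ** witness_basis\<^sup>\<dagger> = mat 1" "W ** W\<^sup>\<dagger> = mat 1"
    using W witness_basis_unitary matrix_left_right_inverse by blast+
  then have "?u\<^sup>\<dagger> ** ?u = mat 1"
    using witness_basis_unitary
    by (metis hadjoint_hadjoint hadjoint_mult matrix_mul_assoc matrix_mul_rid)
  then obtain w where w: "w \<in> SU" "\<forall>X. w ** X ** w\<^sup>\<dagger> = ?u ** X ** ?u\<^sup>\<dagger>"
    by (rule unitary_phase_to_SU)
  define U where "U = dicke ** w ** dicke\<^sup>\<dagger>"
  define Y where "Y = W ** real_diag (l \<circ> \<pi>) ** W\<^sup>\<dagger>"
  have "separable_state (U ** (dicke ** Y ** dicke\<^sup>\<dagger>) ** U\<^sup>\<dagger>)"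
    using sas w(1) unfolding X Y_def U_def SAS_def SU_sym_def by blast
  also have "U ** (dicke ** Y ** dicke\<^sup>\<dagger>) ** U\<^sup>\<dagger>
      = dicke ** w ** (dicke\<^sup>\<dagger> ** dicke) ** Y ** (dicke\<^sup>\<dagger> ** dicke) ** w\<^sup>\<dagger> ** dicke\<^sup>\<dagger>"
    by (simp add: U_def hadjoint_mult matrix_mul_assoc)
  also have "\<dots> = dicke ** (w ** Y ** w\<^sup>\<dagger>) ** dicke\<^sup>\<dagger>"
    by (simp add: dicke_isometry matrix_mul_assoc)
  also have "w ** Y ** w\<^sup>\<dagger> = witness_basis ** (W\<^sup>\<dagger> ** W) ** real_diag (l \<circ> \<pi>) ** (W\<^sup>\<dagger> ** W) ** witness_basis\<^sup>\<dagger>"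
    unfolding w(2)[rule_format] Y_def by (simp add: hadjoint_mult matrix_mul_assoc)
  also have "\<dots> = witness_basis ** real_diag (l \<circ> \<pi>) ** witness_basis\<^sup>\<dagger>"
    by (simp add: W)
  finally have "0 \<le> ghz_witness (dicke ** (witness_basis ** real_diag (l \<circ> \<pi>) ** witness_basis\<^sup>\<dagger>) ** dicke\<^sup>\<dagger>)"
    by (rule separable_ghz_witness_nonneg)
  then show ?thesis by (simp add: ghz_witness_spectral field_simps)
qed

text \<open>In the gaps \<open>a, b, c\<close> between consecutive entries, the constraint reads
  \<open>7 a + 6 b + 5 c \<le> 1\<close>, and the left-hand side of the conclusion is the quadratic form
  \<open>(3 a\<^sup>2 + 4 b\<^sup>2 + 3 c\<^sup>2 + 4 a b + 2 a c + 4 b c) / 4\<close>, which is coefficientwise at most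
  \<open>3/100 (7 a + 6 b + 5 c)\<^sup>2\<close>.\<close>

lemma sorted_spectrum_variance_le:
  fixes x1 x2 x3 x4 :: real
  assumes sorted: "x2 \<le> x1" "x3 \<le> x2" "x4 \<le> x3" and sum: "x1 + x2 + x3 + x4 = 1"
    and le: "3 * x1 \<le> x2 + x3 + 3 * x4"
  shows "(x1 - 1/4)\<^sup>2 + (x2 - 1/4)\<^sup>2 + (x3 - 1/4)\<^sup>2 + (x4 - 1/4)\<^sup>2 \<le> 3/100"
proof -
  define a b c where "a = x1 - x2" and "b = x2 - x3" and "c = x3 - x4"
  have pos: "0 \<le> a" "0 \<le> b" "0 \<le> c" using sorted by (simp_all add: a_def b_def c_def)
  have x: "x1 - 1/4 = (3 * a + 2 * b + c) / 4" "x2 - 1/4 = (- a + 2 * b + c) / 4"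
    "x3 - 1/4 = (- a - 2 * b + c) / 4" "x4 - 1/4 = (- a - 2 * b - 3 * c) / 4"
    using sum by (simp_all add: a_def b_def c_def field_simps)
  have "7 * a + 6 * b + 5 * c \<le> 1"
    using le sum by (simp add: a_def b_def c_def)
  then have "(7 * a + 6 * b + 5 * c)\<^sup>2 \<le> 1\<^sup>2"
    using pos by (intro power_mono) auto
  then have "49 * (a * a) + 36 * (b * b) + 25 * (c * c)
      + 84 * (a * b) + 70 * (a * c) + 60 * (b * c) \<le> 1"
    by (simp add: power2_eq_square algebra_simps)
  moreover have "(x1 - 1/4)\<^sup>2 + (x2 - 1/4)\<^sup>2 + (x3 - 1/4)\<^sup>2 + (x4 - 1/4)\<^sup>2
      = (3 * (a * a) + 4 * (b * b) + 3 * (c * c) + 4 * (a * b) + 2 * (a * c) + 4 * (b * c)) / 4"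
    unfolding x power2_eq_square by (simp add: field_simps)
  moreover have "0 \<le> a * a" "0 \<le> b * b" "0 \<le> c * c" "0 \<le> a * b" "0 \<le> a * c" "0 \<le> b * c"
    using pos by simp_all
  \<comment> \<open>With the six monomials as independent nonnegative variables, the claim is
    linear: 3/100 times the hypothesis dominates termwise. Only the coefficient of \<open>C\<close>
    is tight, which corresponds to the spectrum (3, 3, 3, 1)/10.\<close>
  moreover have "(3 * A + 4 * B + 3 * C + 4 * D + 2 * E + 4 * F) / 4 \<le> 3/100"
    if "49 * A + 36 * B + 25 * C + 84 * D + 70 * E + 60 * F \<le> 1"
      "0 \<le> A" "0 \<le> B" "0 \<le> C" "0 \<le> D" "0 \<le> E" "0 \<le> F" for A B C D E F :: real
    using that by argo
  ultimately show ?thesis by presburger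
qed

lemma SAS_hs_dist_le:
  assumes "\<rho> \<in> SAS"
  shows "hs_dist \<rho> rho0 \<le> sqrt 3 / 10"
proof -
  have "symmetric_state \<rho>" using assms by (simp add: SAS_def)
  then obtain X :: "complex^4^4" where X: "\<rho> = dicke ** X ** dicke\<^sup>\<dagger>" "X\<^sup>\<dagger> = X" "trace X = 1"
    by (rule symmetric_state_decompose)
  from X(2) obtain V :: "complex^4^4" and l where V: "V\<^sup>\<dagger> ** V = mat 1" "X = V ** real_diag l ** V\<^sup>\<dagger>"
    by (rule hermitian_spectral)
  obtain \<pi> where \<pi>: "\<pi> permutes UNIV" "l (\<pi> 2) \<le> l (\<pi> 1)" "l (\<pi> 3) \<le> l (\<pi> 2)" "l (\<pi> 4) \<le> l (\<pi> 3)"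
    by (rule sorting_permutation_4)
  have "trace (real_diag l) = 1" using X(3) V trace_isometry_conj[OF V(1)] by simp
  then have "complex_of_real (\<Sum>i\<in>UNIV. l i) = 1" by (simp add: trace_def real_diag_def)
  then have "(\<Sum>i\<in>UNIV. l i) = 1" using of_real_eq_1_iff by blast
  then have "(\<Sum>i\<in>UNIV. l (\<pi> i)) = 1" using sum.permute[OF \<pi>(1), of l] by (simp add: o_def)
  then have sum1: "l (\<pi> 1) + l (\<pi> 2) + l (\<pi> 3) + l (\<pi> 4) = 1" by (simp only: sum_4)
  have "3 * l (\<pi> 1) \<le> l (\<pi> 2) + l (\<pi> 3) + 3 * l (\<pi> 4)"
    using assms unfolding X(1) V(2) by (rule SAS_spectrum[OF V(1) \<pi>(1)])
  from sorted_spectrum_variance_le[OF \<pi>(2-4) sum1 this]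
  have "(\<Sum>i\<in>UNIV. (l (\<pi> i) - 1/4)\<^sup>2) \<le> 3/100" by (simp only: sum_4)
  then have "(\<Sum>i\<in>UNIV. (l i - 1/4)\<^sup>2) \<le> 3/100"
    using sum.permute[OF \<pi>(1), of "\<lambda>i. (l i - 1/4)\<^sup>2"] by (simp add: o_def)
  then have "hs_dist \<rho> rho0 \<le> sqrt (3/100)"
    unfolding X(1) hs_dist_rho0 V(2) hs_dist_unitary_diag_scaled_id[OF V(1)] by simp
  also have "sqrt (3/100) = sqrt 3 / 10" by (simp add: real_sqrt_divide)
  finally show ?thesis .
qed

text \<open>Moving from \<open>rho0\<close> along the normal of the bounding hyperplane crosses it
  at distance \<open>1 / (2 * sqrt 19)\<close>; a state slightly further out still lies in the ball
  but violates the spectral inequality.\<close>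

lemma sym_ball_not_subset_SAS:
  assumes r: "1 / (2 * sqrt 19) < r"
  shows "\<not> sym_ball r \<subseteq> SAS"
proof
  assume sub: "sym_ball r \<subseteq> SAS"
  \<comment> \<open>The hyperplane is crossed at \<open>s = 1/19\<close>; \<open>1/5\<close> keeps
    the smallest eigenvalue nonnegative, and the other bound keeps the distance
    \<open>s * sqrt 19 / 2\<close> within \<open>r\<close>.\<close>
  define s where "s = min (1/5) (2 * r / sqrt 19)"
  have "1 / 19 < 2 * r / sqrt 19"
  proof -
    have "1 < r * (2 * sqrt 19)" using r by (simp add: divide_less_eq)
    moreover have "2 * r / sqrt 19 = r * (2 * sqrt 19) / 19" by (simp add: field_simps)
    ultimately show ?thesis by simp
  qed
  then have s: "1 / 19 < s" "s \<le> 1/5" "s \<le> 2 * r / sqrt 19" by (simp_all add: s_def)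
  \<comment> \<open>(7, -1, -1, -5) is twice the trace-free part of the normal (3, -1, -1,
    -3).\<close>
  define l :: "4 \<Rightarrow> real"
    where "l k = 1/4 + s/4 * (if k = 1 then 7 else if k = 4 then - 5 else - 1)" for k
  define X where "X = witness_basis ** real_diag l ** witness_basis\<^sup>\<dagger>"
  have "0 \<le> l k" for k using s by (simp add: l_def)
  moreover have "sum l UNIV = 1" by (simp add: sum_4 l_def)
  ultimately have "density_operator X"
    unfolding X_def by (intro density_operator_isometry_conj[OF witness_basis_unitary] density_operator_real_diag)
  then have "symmetric_state (dicke ** X ** dicke\<^sup>\<dagger>)" by (rule symmetric_state_dicke_conj)
  moreover have "hs_dist (dicke ** X ** dicke\<^sup>\<dagger>) rho0 \<le> r"
  proof -
    have "(\<Sum>i\<in>UNIV. (l i - 1/4)\<^sup>2) = (s * sqrt 19 / 2)\<^sup>2"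
      by (simp add: sum_4 l_def power2_eq_square algebra_simps)
    then have "hs_dist (dicke ** X ** dicke\<^sup>\<dagger>) rho0 = s * sqrt 19 / 2"
      unfolding hs_dist_rho0 X_def hs_dist_unitary_diag_scaled_id[OF witness_basis_unitary]
      using s by simp
    also have "\<dots> \<le> r" using s(3) by (simp add: field_simps)
    finally show ?thesis .
  qed
  ultimately have "dicke ** X ** dicke\<^sup>\<dagger> \<in> SAS" using sub by (auto simp: sym_ball_def)
  then have "3 * l (id 1) \<le> l (id 2) + l (id 3) + 3 * l (id 4)"
    unfolding X_def by (rule SAS_spectrum[OF witness_basis_unitary permutes_id])
  with s show False by (simp add: l_def)
qed

section \<open>Existence of the extremal radii\<close>

section \<open>Existence of the extremal radii\<close>

text \<open>Product projectors are a continuous image of a product of three unit spheres, and the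
  convex hull of a compact set is compact in finite dimension. Triples are encoded as vectors so
  that compactness is closedness plus boundedness.\<close>

lemma closed_separable: "closed {\<sigma>. separable_state \<sigma>}"
proof -
  let ?K = "{x :: (complex^2)^3. \<forall>q. norm (x $ q) = 1}"
  have "bounded ?K"
  proof (rule boundedI)
    fix x :: "(complex^2)^3" assume "x \<in> ?K"
    then show "norm x \<le> 3"
      using L2_set_le_sum[of UNIV "\<lambda>q. norm (x $ q)"] by (simp add: norm_vec_def)
  qed
  moreover have "closed ?K"
    by (intro closed_Collect_all closed_Collect_eq continuous_intros)
  ultimately have "compact ?K" by (simp add: compact_eq_bounded_closed)
  moreover have "continuous_on ?K (\<lambda>x. ketbra (tensor (\<lambda>q. x $ q)))"
    unfolding ketbra_def tensor_def
    by (auto intro!: continuous_intros continuous_on_vec_lambda)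
  ultimately have "compact ((\<lambda>x. ketbra (tensor (\<lambda>q. x $ q))) ` ?K)"
    by (rule compact_continuous_image[rotated])
  moreover have "(\<lambda>x. ketbra (tensor (\<lambda>q. x $ q))) ` ?K = {ketbra (tensor \<psi>) |\<psi>. \<forall>q. norm (\<psi> q) = 1}"
  proof (intro equalityI subsetI)
    fix \<sigma> assume "\<sigma> \<in> {ketbra (tensor \<psi>) |\<psi>. \<forall>q. norm (\<psi> q) = 1}"
    then obtain \<psi> where "\<sigma> = ketbra (tensor \<psi>)" "\<forall>q. norm (\<psi> q) = 1" by blast
    then show "\<sigma> \<in> (\<lambda>x. ketbra (tensor (\<lambda>q. x $ q))) ` ?K"
      by (intro image_eqI[of _ _ "\<chi> q. \<psi> q"]) auto
  qed auto
  ultimately show ?thesis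
    by (simp add: separable_state_def compact_convex_hull compact_imp_closed)
qed

text \<open>The six vertices of an octahedron in the Bloch sphere form a spherical 3-design.\<close>

lemma separable_rho0: "separable_state rho0"
proof -
  define h where "h = complex_of_real (1 / sqrt 2)"
  define v :: "nat \<Rightarrow> complex^2" where "v i =
    (if i < 4 then (\<chi> j. if j = 1 then \<i> ^ i * h else h)
     else if i = 4 then (\<chi> j. if j = 1 then 0 else 1) else (\<chi> j. if j = 1 then 1 else 0))" for i
  have "norm (v i) = 1" for i
    by (simp add: v_def norm_vec_def L2_set_def sum_2 norm_mult norm_power h_def norm_divide norm_power power_divide)
  then have "(\<Sum>i<6. (1/6) *\<^sub>R ketbra (tensor (\<lambda>_. v i))) \<in>
      convex hull {ketbra (tensor \<psi>) |\<psi>. \<forall>q. norm (\<psi> q) = 1}"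
    by (intro convex_sum convex_convex_hull hull_inc) auto
  moreover have "(\<Sum>i<6. (1/6) *\<^sub>R ketbra (tensor (\<lambda>_. v i))) $ b $ b' = rho0 $ b $ b'" for b b'
  proof -
    have t: "tensor (\<lambda>_. v i) $ c = (if i < 4 then \<i> ^ (i * weight c) * h ^ 3
      else if i = 4 then 0 ^ weight c else 0 ^ (3 - weight c))" for i c
    proof -
      have "h ^ weight c * h ^ (3 - weight c) = h ^ 3"
        using weight_le[of c] by (simp flip: power_add)
      then show ?thesis
        by (simp add: v_def tensor_const power_mult_distrib power_mult mult.assoc)
    qed
    have h6: "h ^ 3 * cnj (h ^ 3) = 1 / 8"
    proof -
      have "h * cnj h = 1 / 2" by (simp add: h_def flip: of_real_mult)
      then have "(h * cnj h) ^ 3 = 1 / 8" by (simp only:) (simp add: power_divide)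
      then show ?thesis by (simp add: power_mult_distrib)
    qed
    \<comment> \<open>\<open>z\<close> is \<open>\<i>\<close> to the difference of the weights. As
      weights are at most 3, the four powers sum to 0 unless the weights agree. The equator thus
      gives 1/2 on the diagonal, and the poles add 1 at weights 0 and 3 (where
      \<open>0 ^ 0 = 1\<close>).\<close>
    define z where "z = \<i> ^ weight b * (- \<i>) ^ weight b'"
    have k: "ketbra (tensor (\<lambda>_. v i)) $ b $ b' = z ^ i / 8" if "i < 4" for i
    proof -
      have "ketbra (tensor (\<lambda>_. v i)) $ b $ b'
          = \<i> ^ (i * weight b) * (- \<i>) ^ (i * weight b') * (h ^ 3 * cnj (h ^ 3))"
        using that by (simp add: ketbra_def t)
      also have "\<i> ^ (i * weight b) * (- \<i>) ^ (i * weight b') = z ^ i"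
        unfolding z_def power_mult_distrib by (simp only: mult.commute[of i] power_mult)
      finally show ?thesis by (simp only: h6) simp
    qed
    have "(\<Sum>i<6. (1/6) *\<^sub>R ketbra (tensor (\<lambda>_. v i))) $ b $ b' =
      ((\<Sum>i<4. z ^ i) / 8 + 0 ^ weight b * 0 ^ weight b'
        + 0 ^ (3 - weight b) * 0 ^ (3 - weight b')) / 6"
    proof -
      have "{..<6} = {..<4} \<union> {4, 5 :: nat}" by auto
      then have "(\<Sum>i<6. (1/6) *\<^sub>R ketbra (tensor (\<lambda>_. v i))) $ b $ b'
          = (\<Sum>i<4. ketbra (tensor (\<lambda>_. v i)) $ b $ b' / 6)
            + (ketbra (tensor (\<lambda>_. v 4)) $ b $ b' / 6 + ketbra (tensor (\<lambda>_. v 5)) $ b $ b' / 6)"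
        by (simp add: sum.union_disjoint scaleR_conv_of_real[where 'a = complex])
      also have "(\<Sum>i<4. ketbra (tensor (\<lambda>_. v i)) $ b $ b' / 6) = (\<Sum>i<4. z ^ i) / 8 / 6"
        by (simp add: k flip: sum_divide_distrib)
      finally show ?thesis by (simp add: ketbra_def t add_divide_distrib)
    qed
    also have "\<dots> = (if weight b = weight b' then 1 / of_nat (4 * (3 choose weight b)) else 0)"
    proof -
      have "weight c \<in> {0, 1, 2, 3}" for c using weight_le[of c] by auto
      from this[of b] this[of b'] show ?thesis
        unfolding z_def
        by (auto simp: numeral_eq_Suc)
    qed
    also have "\<dots> = rho0 $ b $ b'"
      by (simp add: rho0_def dicke_conj_nth mat_def of_nat_4_inj[OF weight_le weight_le]
          scaleR_conv_of_real[where 'a = complex] flip: of_real_mult)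
    finally show ?thesis .
  qed
  then have "(\<Sum>i<6. (1/6) *\<^sub>R ketbra (tensor (\<lambda>_. v i))) = rho0"
    unfolding vec_eq_iff by blast
  ultimately show ?thesis by (simp add: separable_state_def)
qed

lemma SU_sym_rho0:
  assumes "U \<in> SU_sym"
  shows "U ** rho0 ** U\<^sup>\<dagger> = rho0"
proof -
  obtain u :: "complex^4^4" where u: "U = dicke ** u ** dicke\<^sup>\<dagger>" "u ** u\<^sup>\<dagger> = mat 1"
    using assms by (auto simp: SU_sym_def SU_def)
  let ?c = "(1/4) *\<^sub>R mat 1 :: complex^4^4"
  have "U ** rho0 ** U\<^sup>\<dagger>
      = dicke ** (u ** (dicke\<^sup>\<dagger> ** dicke) ** ?c ** (dicke\<^sup>\<dagger> ** dicke) ** u\<^sup>\<dagger>) ** dicke\<^sup>\<dagger>"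
    by (simp only: u(1) rho0_def hadjoint_mult hadjoint_hadjoint matrix_mul_assoc)
  also have "u ** (dicke\<^sup>\<dagger> ** dicke) ** ?c ** (dicke\<^sup>\<dagger> ** dicke) ** u\<^sup>\<dagger> = ?c"
    by (simp add: dicke_isometry matrix_mult_scaleR_left matrix_mult_scaleR_right u(2))
  finally show ?thesis by (simp add: rho0_def)
qed

lemma symmetric_state_rho0: "symmetric_state rho0"
proof -
  have "(1/4) *\<^sub>R mat 1 = (real_diag (\<lambda>_. 1/4) :: complex^4^4)"
    by (simp add: vec_eq_iff mat_def real_diag_def scaleR_conv_of_real[where 'a = complex])
  moreover have "density_operator (real_diag (\<lambda>_. 1/4) :: complex^4^4)"
    by (rule density_operator_real_diag) (simp_all add: sum_4)
  ultimately show ?thesis unfolding rho0_def by (metis symmetric_state_dicke_conj)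
qed

lemma rho0_in_SAS: "rho0 \<in> SAS"
  by (simp add: SAS_def symmetric_state_rho0 SU_sym_rho0 separable_rho0)

section \<open>Approximation by smaller balls and attainment of the radii\<close>

lemma symmetric_state_convex:
  assumes "symmetric_state \<rho>" "symmetric_state \<sigma>" "0 \<le> e" "e \<le> 1"
  shows "symmetric_state ((1 - e) *\<^sub>R \<rho> + e *\<^sub>R \<sigma>)"
proof -
  let ?\<tau> = "(1 - e) *\<^sub>R \<rho> + e *\<^sub>R \<sigma>"
  have mult: "?\<tau> *v v = (1 - e) *\<^sub>R (\<rho> *v v) + e *\<^sub>R (\<sigma> *v v)" for v
    by (simp add: vec_eq_iff matrix_vector_mult_def distrib_right sum.distrib scaleR_right.sum)
  have "?\<tau>\<^sup>\<dagger> = (1 - e) *\<^sub>R \<rho>\<^sup>\<dagger> + e *\<^sub>R \<sigma>\<^sup>\<dagger>"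
    by (simp add: vec_eq_iff)
  moreover have "trace ?\<tau> = (1 - e) *\<^sub>R trace \<rho> + e *\<^sub>R trace \<sigma>"
    by (simp add: trace_def sum.distrib scaleR_right.sum)
  moreover have "Re (cinner v (?\<tau> *v v)) =
      (1 - e) * Re (cinner v (\<rho> *v v)) + e * Re (cinner v (\<sigma> *v v))" for v
    unfolding mult by (simp add: inner_add_right flip: inner_eq_Re_cinner)
  ultimately have "density_operator ?\<tau>"
    using assms by (simp add: symmetric_state_def density_operator_def flip: scaleR_add_left)
  moreover have "?\<tau> *v v \<in> sym_space" for v
  proof -
    have "\<rho> *v v \<in> sym_space" "\<sigma> *v v \<in> sym_space"
      using assms by (auto simp: symmetric_state_def)
    then show ?thesis unfolding mult by (simp add: sym_space_def permute_qubits_def vec_eq_iff)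
  qed
  ultimately show ?thesis by (auto simp: symmetric_state_def)
qed

text \<open>Contracting \<open>\<rho>\<close> towards \<open>rho0\<close> puts it into a strictly
  smaller ball. Since \<open>U\<close> fixes \<open>rho0\<close>, the rotated contractions are the
  points \<open>f n\<close> on the segment from \<open>rho0\<close> to the rotated
  \<open>\<rho>\<close>, and closedness carries separability to the limit.\<close>

lemma sym_ball_subset_SAS_if_smaller:
  assumes "0 < r" and sub: "\<And>t. 0 \<le> t \<Longrightarrow> t < r \<Longrightarrow> sym_ball t \<subseteq> SAS"
  shows "sym_ball r \<subseteq> SAS"
proof
  fix \<rho> assume "\<rho> \<in> sym_ball r"
  then have \<rho>: "symmetric_state \<rho>" "hs_dist \<rho> rho0 \<le> r" by (simp_all add: sym_ball_def)
  have "separable_state (U ** \<rho> ** U\<^sup>\<dagger>)" if U: "U \<in> SU_sym" for U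
  proof -
    define \<sigma> where "\<sigma> = U ** \<rho> ** U\<^sup>\<dagger>"
    define f where "f n = (1 - 1 / (real n + 1)) *\<^sub>R \<sigma> + (1 / (real n + 1)) *\<^sub>R rho0" for n
    have "separable_state (f n)" for n
    proof -
      define e where "e = 1 / (real n + 1)"
      have e: "0 < e" "e \<le> 1" by (simp_all add: e_def)
      define \<tau> where "\<tau> = (1 - e) *\<^sub>R \<rho> + e *\<^sub>R rho0"
      have "hs_dist \<tau> rho0 = (1 - e) * hs_dist \<rho> rho0"
        using e by (simp add: \<tau>_def hs_dist_scaleR)
      also have "\<dots> \<le> (1 - e) * r" using e \<rho>(2) by (intro mult_left_mono) auto
      finally have "\<tau> \<in> sym_ball ((1 - e) * r)"
        using e \<rho>(1) by (simp add: sym_ball_def \<tau>_def symmetric_state_convex symmetric_state_rho0)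
      moreover have "sym_ball ((1 - e) * r) \<subseteq> SAS"
        using e \<open>0 < r\<close> by (intro sub) auto
      ultimately have "separable_state (U ** \<tau> ** U\<^sup>\<dagger>)" using U by (auto simp: SAS_def)
      also have "U ** \<tau> ** U\<^sup>\<dagger> = f n"
        by (simp add: \<tau>_def f_def \<sigma>_def matrix_add_ldistrib matrix_mult_add_left
            matrix_mult_scaleR_left matrix_mult_scaleR_right SU_sym_rho0[OF U] flip: e_def)
      finally show ?thesis .
    qed
    moreover have "f \<longlonglongrightarrow> (1 - 0) *\<^sub>R \<sigma> + 0 *\<^sub>R rho0"
    proof -
      have "(\<lambda>n. 1 / (real n + 1)) \<longlonglongrightarrow> 0"
        using LIMSEQ_Suc[OF lim_1_over_n] by (simp add: add.commute)
      then show ?thesis unfolding f_def by (intro tendsto_intros)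
    qed
    ultimately have "\<sigma> \<in> {\<sigma>. separable_state \<sigma>}"
      using closed_sequentially[OF closed_separable, of f] by simp
    then show ?thesis by (simp add: \<sigma>_def)
  qed
  with \<rho> show "\<rho> \<in> SAS" by (simp add: SAS_def)
qed

text \<open>The work is to show that \<open>Sup S\<close> belongs to \<open>S\<close>, so that
  \<open>GREATEST\<close> denotes it; the numerical bound then holds for it as for every
  member.\<close>

lemma r_SAS_le: "r_SAS \<le> 1 / (2 * sqrt 19)"
proof -
  define S where "S = {r. 0 \<le> r \<and> sym_ball r \<subseteq> SAS}"
  have mono: "sym_ball s \<subseteq> sym_ball t" if "s \<le> t" for s t
    using that by (auto simp: sym_ball_def)
  have "\<rho> = rho0" if "\<rho> \<in> sym_ball 0" for \<rho>
    using that hs_dist_nonneg[of \<rho> rho0] hs_dist_eq_0[of \<rho> rho0] by (simp add: sym_ball_def)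
  then have S0: "0 \<in> S" using rho0_in_SAS by (auto simp: S_def)
  have ub: "r \<le> 1 / (2 * sqrt 19)" if "r \<in> S" for r
    using that sym_ball_not_subset_SAS[of r] by (simp add: S_def flip: not_less) blast
  then have bdd: "bdd_above S" by (rule bdd_aboveI)
  have "0 \<le> Sup S" using S0 bdd by (rule cSup_upper)
  moreover have "sym_ball (Sup S) \<subseteq> SAS"
  \<comment> \<open>Radius 0 has no smaller balls to approximate from; there the ball is just
    \<open>rho0\<close>.\<close>
  proof (cases "Sup S = 0")
    case True
    with S0 show ?thesis by (simp add: S_def)
  next
    case False
    with \<open>0 \<le> Sup S\<close> have "0 < Sup S" by simp
    then show ?thesis
    proof (rule sym_ball_subset_SAS_if_smaller)
      fix t assume "0 \<le> t" "t < Sup S"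
      then obtain s where "s \<in> S" "t < s" using S0 less_cSupE[of t S] by blast
      then show "sym_ball t \<subseteq> SAS" using mono[of t s] by (auto simp: S_def)
    qed
  qed
  ultimately have "Sup S \<in> S" by (simp add: S_def)
  moreover have "r_SAS = Sup S"
    unfolding r_SAS_def using \<open>Sup S \<in> S\<close> cSup_upper[OF _ bdd]
    by (intro Greatest_equality) (auto simp: S_def)
  ultimately show ?thesis using ub by simp
qed

text \<open>Membership in \<open>S\<close> is a family of lower bounds on \<open>r\<close>, and
  these pass to the infimum; the spectral bound makes \<open>S\<close> nonempty.\<close>

lemma R_SAS_le: "R_SAS \<le> sqrt 3 / 10"
proof -
  define S where "S = {r. 0 \<le> r \<and> SAS \<subseteq> sym_ball r}"
  have S_iff: "r \<in> S \<longleftrightarrow> 0 \<le> r \<and> (\<forall>\<rho>\<in>SAS. hs_dist \<rho> rho0 \<le> r)" for r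
    by (auto simp: S_def sym_ball_def SAS_def)
  have bound: "sqrt 3 / 10 \<in> S" using SAS_hs_dist_le by (simp add: S_iff)
  have bdd: "bdd_below S" by (auto simp: bdd_below_def S_iff)
  have "S \<noteq> {}" using bound by blast
  then have "Inf S \<in> S"
    unfolding S_iff by (auto intro!: cInf_greatest simp: S_iff)
  then have "R_SAS = Inf S"
    unfolding R_SAS_def using cInf_lower[OF _ bdd]
    by (intro Least_equality) (auto simp: S_def)
  then show ?thesis using cInf_lower[OF bound bdd] by simp
qed

theorem mainTheorem6:
  "r_SAS \<le> 1 / (2 * sqrt 19) \<and> R_SAS \<le> sqrt 3 / 10"
  using r_SAS_le R_SAS_le by blast

end
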